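(* Let $M\neq\{0\}$ be a bipotent semiring, let $\mathfrak q:=\mathrm{Nil}\,M=\{x\in M\mid \exists n\in\mathbb N:\ x^n=0\}$, and let $C$ be the equivalence relation on $M$ given by: $x\sim_C y$ iff either $x,y\in\mathfrak q$, or there exists some $s\in M\setminus\mathfrak q$ with $sx=sy$. Then: a) $C$ is a homomorphic equivalence relation on $M$, i.e., $x\sim_C y$ implies $x+z\sim_C y+z$ and $xz\sim_C yz$ for all $z\in M$. Thus there is a unique structure of a (bipotent) semiring on $M/C$ such that the natural map $\pi_C:M\to M/C$, $x\mapsto[x]_C$, is a semiring homomorphism. b) $M/C$ is cancellative and $\pi_C^{-1}(0)=\mathfrak q$. c) If $\gamma:M\to N$ is a semiring homomorphism from $M$ to a cancellative semiring $N$ with $\gamma^{-1}(0)=\mathfrak q$, then $\gamma$ factors through $\pi_C$ in a unique way, i.e., there is a unique semiring homomorphism $\bar\gamma:M/C\to N$ with $\bar\gamma\circ\pi_C=\gamma$.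
   Context: All semirings are commutative with $0$ and $1$. A bipotent semiring is a semiring $M$ equipped with a total ordering such that $(M,\cdot)$ is a totally ordered monoid (the order is compatible with multiplication), $0$ is the smallest element (and is absorbing), and $x+y=\max(x,y)$. A semiring $N$ is cancellative if $xz=yz$ with $z\neq0$ implies $x=y$. Semiring homomorphisms preserve $0$, $1$, addition and multiplication. *)

theory Defs
  imports "HOL-Algebra.Ring" "HOL-Library.FuncSet"
begin

locale commutative_semiring = semiring R + comm_monoid R for R (structure)

text \<open>The total order is a relation \<open>r\<close> on the carrier, with \<open>(x, y) \<in> r\<close> meaning that
  \<open>x\<close> is at most \<open>y\<close>. Absorption by zero is part of the locale \<^locale>\<open>semiring\<close>.\<close>

locale bipotent_semiring = commutative_semiring M for M (structure) and r :: "('a \<times> 'a) set" +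
  assumes linear_order: "linear_order_on (carrier M) r"
    and mult_compat: "\<lbrakk>z \<in> carrier M; (x, y) \<in> r\<rbrakk> \<Longrightarrow> (x \<otimes> z, y \<otimes> z) \<in> r"
    and zero_least: "x \<in> carrier M \<Longrightarrow> (\<zero>, x) \<in> r"
    and add_eq_max: "\<lbrakk>x \<in> carrier M; y \<in> carrier M\<rbrakk> \<Longrightarrow> x \<oplus> y = (if (x, y) \<in> r then y else x)"

locale cancellative_semiring = commutative_semiring N for N (structure) +
  assumes cancel:
    "\<lbrakk>x \<in> carrier N; y \<in> carrier N; z \<in> carrier N; z \<noteq> \<zero>; x \<otimes> z = y \<otimes> z\<rbrakk> \<Longrightarrow> x = y"

text \<open>\<^const>\<open>ring_hom\<close> does not ask that zero be preserved, which is not automatic for semirings.\<close>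

definition semiring_hom ::
    "('a, 'm) ring_scheme \<Rightarrow> ('b, 'n) ring_scheme \<Rightarrow> ('a \<Rightarrow> 'b) set"
  where "semiring_hom R S = {h \<in> ring_hom R S. h \<zero>\<^bsub>R\<^esub> = \<zero>\<^bsub>S\<^esub>}"

definition Nil_rad :: "('a, 'm) ring_scheme \<Rightarrow> 'a set"
  where "Nil_rad M = {x \<in> carrier M. \<exists>n::nat. x [^]\<^bsub>M\<^esub> n = \<zero>\<^bsub>M\<^esub>}"

definition C_rel :: "('a, 'm) ring_scheme \<Rightarrow> ('a \<times> 'a) set"
  where "C_rel M = {(x, y). x \<in> carrier M \<and> y \<in> carrier M \<and>
    ((x \<in> Nil_rad M \<and> y \<in> Nil_rad M) \<or>
     (\<exists>s \<in> carrier M - Nil_rad M. s \<otimes>\<^bsub>M\<^esub> x = s \<otimes>\<^bsub>M\<^esub> y))}"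

definition homomorphic_equiv :: "('a, 'm) ring_scheme \<Rightarrow> ('a \<times> 'a) set \<Rightarrow> bool"
  where "homomorphic_equiv M E \<longleftrightarrow> equiv (carrier M) E \<and>
    (\<forall>x y z. (x, y) \<in> E \<and> z \<in> carrier M \<longrightarrow>
      (x \<oplus>\<^bsub>M\<^esub> z, y \<oplus>\<^bsub>M\<^esub> z) \<in> E \<and> (x \<otimes>\<^bsub>M\<^esub> z, y \<otimes>\<^bsub>M\<^esub> z) \<in> E)"

text \<open>The operations on classes. If \<open>E\<close> is homomorphic, the sets joined in each union all
  coincide, so that the union is the class of \<open>x \<otimes> y\<close> (or \<open>x \<oplus> y\<close>) for any representatives.\<close>

definition quot_semiring :: "('a, 'm) ring_scheme \<Rightarrow> ('a \<times> 'a) set \<Rightarrow> 'a set ring"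
  where "quot_semiring M E =
    \<lparr>carrier = carrier M // E,
     monoid.mult = (\<lambda>X Y. \<Union>x\<in>X. \<Union>y\<in>Y. Equiv_Relations.proj E (x \<otimes>\<^bsub>M\<^esub> y)),
     one = Equiv_Relations.proj E \<one>\<^bsub>M\<^esub>,
     zero = Equiv_Relations.proj E \<zero>\<^bsub>M\<^esub>,
     add = (\<lambda>X Y. \<Union>x\<in>X. \<Union>y\<in>Y. Equiv_Relations.proj E (x \<oplus>\<^bsub>M\<^esub> y))\<rparr>"

text \<open>Equality of two semiring structures on one carrier set; the values of the operations
  outside the carrier are irrelevant.\<close>

definition same_structure :: "('a, 'm) ring_scheme \<Rightarrow> ('a, 'n) ring_scheme \<Rightarrow> bool"
  where "same_structure R S \<longleftrightarrow> carrier R = carrier S \<and> \<zero>\<^bsub>R\<^esub> = \<zero>\<^bsub>S\<^esub> \<and> \<one>\<^bsub>R\<^esub> = \<one>\<^bsub>S\<^esub> \<and>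
    (\<forall>x \<in> carrier R. \<forall>y \<in> carrier R.
      x \<oplus>\<^bsub>R\<^esub> y = x \<oplus>\<^bsub>S\<^esub> y \<and> x \<otimes>\<^bsub>R\<^esub> y = x \<otimes>\<^bsub>S\<^esub> y)"

end

theory Submission
  imports Defs
begin

text \<open>In a bipotent semiring the order is recovered from the addition, since \<open>x\<close> is at most \<open>y\<close>
  iff \<open>x + y = y\<close>. Hence a semiring is bipotent, for exactly one order, as soon as every sum is one
  of its two summands, and this property passes to quotients. The nilradical is a lower set and,
  because \<open>x \<le> y\<close> gives \<open>x\<^sup>2 \<le> xy\<close>, a prime ideal; its complement is therefore multiplicatively
  closed, and the relation is that of a localization at this complement, with the nilradical
  collapsed to zero.\<close>

section \<open>Semiring homomorphisms and surjective images\<close>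

lemma semiring_homI:
  assumes "\<And>x. x \<in> carrier R \<Longrightarrow> h x \<in> carrier S"
    and "\<And>x y. \<lbrakk>x \<in> carrier R; y \<in> carrier R\<rbrakk> \<Longrightarrow> h (x \<otimes>\<^bsub>R\<^esub> y) = h x \<otimes>\<^bsub>S\<^esub> h y"
    and "\<And>x y. \<lbrakk>x \<in> carrier R; y \<in> carrier R\<rbrakk> \<Longrightarrow> h (x \<oplus>\<^bsub>R\<^esub> y) = h x \<oplus>\<^bsub>S\<^esub> h y"
    and "h \<one>\<^bsub>R\<^esub> = \<one>\<^bsub>S\<^esub>" and "h \<zero>\<^bsub>R\<^esub> = \<zero>\<^bsub>S\<^esub>"
  shows "h \<in> semiring_hom R S"
  using assms by (simp add: semiring_hom_def ring_hom_memI)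

lemma semiring_homD:
  assumes "h \<in> semiring_hom R S"
  shows "\<And>x. x \<in> carrier R \<Longrightarrow> h x \<in> carrier S"
    and "\<And>x y. \<lbrakk>x \<in> carrier R; y \<in> carrier R\<rbrakk> \<Longrightarrow> h (x \<otimes>\<^bsub>R\<^esub> y) = h x \<otimes>\<^bsub>S\<^esub> h y"
    and "\<And>x y. \<lbrakk>x \<in> carrier R; y \<in> carrier R\<rbrakk> \<Longrightarrow> h (x \<oplus>\<^bsub>R\<^esub> y) = h x \<oplus>\<^bsub>S\<^esub> h y"
    and "h \<one>\<^bsub>R\<^esub> = \<one>\<^bsub>S\<^esub>" and "h \<zero>\<^bsub>R\<^esub> = \<zero>\<^bsub>S\<^esub>"
  using assms by (auto simp: semiring_hom_def dest: ring_hom_memE)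

text \<open>Every element of the common carrier is an image under \<open>h\<close>, so the
  operations of \<open>R\<close> dictate both structures. This gives the uniqueness of the quotient
  structure.\<close>

lemma same_structure_of_surj_hom:
  assumes "h \<in> semiring_hom R S" and "h \<in> semiring_hom R T"
    and "carrier S = h ` carrier R" and "carrier T = carrier S"
  shows "same_structure T S"
  using assms unfolding same_structure_def
  by (auto simp flip: semiring_homD(2-5)[OF assms(1)] simp: semiring_homD(2-5)[OF assms(2)])

text \<open>\<open>S\<close> is not known to be a semiring beforehand. The axioms are closure
  conditions and identities, and these pass to surjective images.\<close>

lemma commutative_semiring_surj_image:
  assumes R: "commutative_semiring R" and h: "h \<in> semiring_hom R S"
    and surj: "carrier S = h ` carrier R"
  shows "commutative_semiring S"
proof -
  interpret R: commutative_semiring R by (rule R)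
  \<comment> \<open>Read backwards, the homomorphism equations reduce each law on images
    \<open>h x\<close> to the same law in \<open>R\<close>.\<close>
  note [simp] = semiring_homD(2-5)[OF h, symmetric]
  have "abelian_monoid S"
    by (rule abelian_monoidI) (auto simp: surj R.a_ac)
  moreover have "comm_monoid S"
    by (rule comm_monoidI) (auto simp: surj R.m_ac)
  moreover have "semiring_axioms S"
    by unfold_locales (auto simp: surj R.l_distr R.r_distr)
  ultimately show ?thesis
    by (simp add: commutative_semiring_def semiring_def comm_monoid_def)
qed

section \<open>Quotients by a homomorphic equivalence\<close>

context
  fixes M :: "('a, 'm) ring_scheme" and E :: "('a \<times> 'a) set"
  assumes M: "commutative_semiring M" and E: "homomorphic_equiv M E"
begin

interpretation commutative_semiring M by (rule M)

text \<open>The point is that the unions in \<open>quot_semiring\<close> are independent of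
  representatives.\<close>

lemma proj_hom: "Equiv_Relations.proj E \<in> semiring_hom M (quot_semiring M E)"
proof -
  have eq: "equiv (carrier M) E"
    and congr: "\<And>x y z. \<lbrakk>(x, y) \<in> E; z \<in> carrier M\<rbrakk>
      \<Longrightarrow> (x \<oplus>\<^bsub>M\<^esub> z, y \<oplus>\<^bsub>M\<^esub> z) \<in> E \<and> (x \<otimes>\<^bsub>M\<^esub> z, y \<otimes>\<^bsub>M\<^esub> z) \<in> E"
    using E by (auto simp: homomorphic_equiv_def)
  have E_carr: "E \<subseteq> carrier M \<times> carrier M"
    using eq by (simp add: equiv_def)
  have resp: "congruent2 E E (\<lambda>x y. Equiv_Relations.proj E (f x y))"
    if f: "\<And>x y. \<lbrakk>x \<in> carrier M; y \<in> carrier M\<rbrakk> \<Longrightarrow> f x y = f y x"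
      and fE: "\<And>x y z. \<lbrakk>(x, y) \<in> E; z \<in> carrier M\<rbrakk> \<Longrightarrow> (f x z, f y z) \<in> E" for f
  proof -
    \<comment> \<open>\<open>homomorphic_equiv\<close> varies only the left operand; commutativity
      supplies the right one.\<close>
    have "(f z x, f z y) \<in> E" if "(x, y) \<in> E" "z \<in> carrier M" for x y z
      using that E_carr fE[OF that] by (auto simp: f)
    then show ?thesis
      by (intro congruent2_commuteI[OF eq]) (auto simp: proj_def f intro!: equiv_class_eq[OF eq])
  qed
  have "congruent2 E E (\<lambda>x y. Equiv_Relations.proj E (x \<otimes>\<^bsub>M\<^esub> y))"
    "congruent2 E E (\<lambda>x y. Equiv_Relations.proj E (x \<oplus>\<^bsub>M\<^esub> y))"
    by (rule resp; simp add: m_comm a_comm congr)+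
  note UN = this[THEN UN_equiv_class2[OF eq eq]]
  show ?thesis
    by (rule semiring_homI)
      (simp_all add: quot_semiring_def proj_preserves UN[folded proj_def])
qed

lemma carrier_quot_semiring:
  "carrier (quot_semiring M E) = Equiv_Relations.proj E ` carrier M"
  by (simp add: quot_semiring_def proj_image)

lemma commutative_semiring_quot: "commutative_semiring (quot_semiring M E)"
  by (rule commutative_semiring_surj_image[OF M proj_hom carrier_quot_semiring])

lemma proj_eq_iff:
  assumes "x \<in> carrier M" "y \<in> carrier M"
  shows "Equiv_Relations.proj E x = Equiv_Relations.proj E y \<longleftrightarrow> (x, y) \<in> E"
  using E assms by (intro proj_iff[of "carrier M"]) (auto simp: homomorphic_equiv_def)

text \<open>Universal property of the quotient. Membership in \<open>extensional\<close> fixes the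
  values off the carrier, so that uniqueness is equality of functions.\<close>

lemma hom_factors_uniquely:
  assumes h: "h \<in> semiring_hom M N" and E_h: "\<And>x y. (x, y) \<in> E \<Longrightarrow> h x = h y"
  shows "\<exists>!g. g \<in> semiring_hom (quot_semiring M E) N \<and> g \<in> extensional (carrier (quot_semiring M E)) \<and>
    (\<forall>x \<in> carrier M. g (Equiv_Relations.proj E x) = h x)"
proof (rule ex_ex1I)
  let ?p = "Equiv_Relations.proj E" and ?Q = "quot_semiring M E"
  note [simp] = semiring_homD(2-5)[OF proj_hom, symmetric]
  \<comment> \<open>\<open>inv_into\<close> chooses a representative of each class; by
    \<open>E_h\<close> the choice does not affect the value.\<close>
  define g where "g = restrict (h \<circ> inv_into (carrier M) ?p) (carrier ?Q)"
  have g: "g (?p x) = h x" if "x \<in> carrier M" for x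
  proof -
    have "inv_into (carrier M) ?p (?p x) \<in> carrier M"
      and "?p (inv_into (carrier M) ?p (?p x)) = ?p x"
      using that by (simp_all add: inv_into_into f_inv_into_f)
    then have "(inv_into (carrier M) ?p (?p x), x) \<in> E"
      using that proj_eq_iff by blast
    then show ?thesis
      using that E_h by (simp add: g_def carrier_quot_semiring)
  qed
  have "g \<in> semiring_hom ?Q N"
    by (rule semiring_homI) (auto simp: carrier_quot_semiring g semiring_homD[OF h])
  moreover have "g \<in> extensional (carrier ?Q)"
    by (simp add: g_def)
  ultimately show "\<exists>g. g \<in> semiring_hom ?Q N \<and> g \<in> extensional (carrier ?Q) \<and>
      (\<forall>x \<in> carrier M. g (?p x) = h x)"
    using g by blast
next
  fix g g'
  assume "g \<in> semiring_hom (quot_semiring M E) N \<and> g \<in> extensional (carrier (quot_semiring M E)) \<and>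
      (\<forall>x \<in> carrier M. g (Equiv_Relations.proj E x) = h x)"
    and "g' \<in> semiring_hom (quot_semiring M E) N \<and> g' \<in> extensional (carrier (quot_semiring M E)) \<and>
      (\<forall>x \<in> carrier M. g' (Equiv_Relations.proj E x) = h x)"
  then show "g = g'"
    by (intro extensionalityI[of g "carrier (quot_semiring M E)"]) (auto simp: carrier_quot_semiring)
qed

end

section \<open>Recovering the order from the addition\<close>

context bipotent_semiring
begin

lemma le_iff_add: "(x, y) \<in> r \<longleftrightarrow> x \<in> carrier M \<and> y \<in> carrier M \<and> x \<oplus> y = y"
proof -
  \<comment> \<open>Reflexivity handles the case where the sum is the left summand and yet equals
    \<open>y\<close>.\<close>
  have "r \<subseteq> carrier M \<times> carrier M" and "y \<in> carrier M \<Longrightarrow> (y, y) \<in> r"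
    using linear_order by (simp_all add: order_on_defs refl_on_def)
  then show ?thesis
    using add_eq_max[of x y] by (auto split: if_splits)
qed

lemma add_in_summands: "\<lbrakk>x \<in> carrier M; y \<in> carrier M\<rbrakk> \<Longrightarrow> x \<oplus> y \<in> {x, y}"
  by (simp add: add_eq_max)

end

text \<open>For the order given by \<open>x \<oplus> y = y\<close>, associativity yields
  transitivity, commutativity antisymmetry, and \<open>sel\<close> reflexivity and totality;
  distributivity makes it compatible with multiplication. Uniqueness is
  \<open>le_iff_add\<close>.\<close>

lemma (in commutative_semiring) ex1_bipotent_order:
  assumes sel: "\<And>x y. \<lbrakk>x \<in> carrier R; y \<in> carrier R\<rbrakk> \<Longrightarrow> x \<oplus> y \<in> {x, y}"
  shows "\<exists>!r. bipotent_semiring R r"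
proof (rule ex_ex1I)
  let ?r = "{(x, y). x \<in> carrier R \<and> y \<in> carrier R \<and> x \<oplus> y = y}"
  have "trans ?r"
  proof (rule transI)
    fix x y z assume "(x, y) \<in> ?r" "(y, z) \<in> ?r"
    then show "(x, z) \<in> ?r"
      using a_assoc[of x y z] by (metis (mono_tags, lifting) case_prod_conv mem_Collect_eq)
  qed
  moreover have "antisym ?r"
  proof (rule antisymI)
    fix x y assume "(x, y) \<in> ?r" "(y, x) \<in> ?r"
    then show "x = y"
      using a_comm[of x y] by simp
  qed
  moreover have "refl_on (carrier R) ?r"
    using sel[of x x for x] by (simp add: refl_on_def)
  moreover have "total_on (carrier R) ?r"
  proof (rule total_onI)
    fix x y assume "x \<in> carrier R" "y \<in> carrier R"
    then show "(x, y) \<in> ?r \<or> (y, x) \<in> ?r"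
      using sel[of x y] a_comm[of x y] by auto
  qed
  ultimately have "linear_order_on (carrier R) ?r"
    by (auto simp: order_on_defs)
  then have "bipotent_semiring R ?r"
  proof unfold_locales
    fix x y assume "x \<in> carrier R" "y \<in> carrier R"
    then show "x \<oplus> y = (if (x, y) \<in> ?r then y else x)"
      using sel[of x y] by auto
  qed (simp_all flip: l_distr)
  then show "\<exists>r. bipotent_semiring R r" ..
next
  fix r r' assume "bipotent_semiring R r" "bipotent_semiring R r'"
  then show "r = r'"
    by (auto simp: bipotent_semiring.le_iff_add)
qed

section \<open>The nilradical as a prime lower set\<close>

context bipotent_semiring
begin

lemma order_carrier: "(x, y) \<in> r \<Longrightarrow> x \<in> carrier M \<and> y \<in> carrier M"
  by (simp add: le_iff_add)

lemma order_trans: "\<lbrakk>(x, y) \<in> r; (y, z) \<in> r\<rbrakk> \<Longrightarrow> (x, z) \<in> r"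
  using linear_order unfolding order_on_defs by (blast intro: transD)

lemma order_total: "\<lbrakk>x \<in> carrier M; y \<in> carrier M\<rbrakk> \<Longrightarrow> (x, y) \<in> r \<or> (y, x) \<in> r"
  using linear_order unfolding order_on_defs refl_on_def total_on_def by metis

lemma le_zero_iff: "(x, \<zero>) \<in> r \<longleftrightarrow> x = \<zero>"
  by (auto simp: le_iff_add)

lemma pow_mono:
  assumes "(x, y) \<in> r"
  shows "(x [^] (n::nat), y [^] n) \<in> r"
proof (induction n)
  case 0
  \<comment> \<open>Totality at \<open>\<one>\<close> and \<open>\<one>\<close> serves as
    reflexivity.\<close>
  show ?case using order_total[of \<one> \<one>] by simp
next
  case (Suc n)
  have xy: "x \<in> carrier M" "y \<in> carrier M"
    using assms order_carrier by auto
  have "(x [^] n \<otimes> x, y [^] n \<otimes> x) \<in> r"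
    using Suc xy by (intro mult_compat)
  moreover have "(y [^] n \<otimes> x, y [^] n \<otimes> y) \<in> r"
    using mult_compat[OF _ assms, of "y [^] n"] xy by (simp add: m_comm)
  ultimately show ?case
    using order_trans by simp
qed

lemma Nil_carrier: "x \<in> Nil_rad M \<Longrightarrow> x \<in> carrier M"
  by (simp add: Nil_rad_def)

lemma zero_in_Nil: "\<zero> \<in> Nil_rad M"
  unfolding Nil_rad_def by (auto intro!: exI[of _ "Suc 0"])

text \<open>Powers are monotone and only zero lies below zero, so an exponent that kills
  \<open>y\<close> also kills \<open>x\<close>.\<close>

lemma Nil_downward: "\<lbrakk>(x, y) \<in> r; y \<in> Nil_rad M\<rbrakk> \<Longrightarrow> x \<in> Nil_rad M"
  using order_carrier[of x y] pow_mono[of x y] by (auto simp: Nil_rad_def) (metis le_zero_iff)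

lemma Nil_mult: "\<lbrakk>x \<in> Nil_rad M; z \<in> carrier M\<rbrakk> \<Longrightarrow> x \<otimes> z \<in> Nil_rad M"
  unfolding Nil_rad_def by (auto simp: nat_pow_distrib) (metis l_null nat_pow_closed)

lemma Nil_of_square:
  assumes "x \<in> carrier M" and "x \<otimes> x \<in> Nil_rad M"
  shows "x \<in> Nil_rad M"
proof -
  obtain n :: nat where "(x \<otimes> x) [^] n = \<zero>"
    using assms by (auto simp: Nil_rad_def)
  then have "x [^] (n + n) = \<zero>"
    using assms(1) by (simp add: nat_pow_distrib flip: nat_pow_mult)
  then show ?thesis
    using assms(1) by (auto simp: Nil_rad_def)
qed

lemma Nil_prime:
  assumes x: "x \<in> carrier M" and y: "y \<in> carrier M" and xy: "x \<otimes> y \<in> Nil_rad M"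
  shows "x \<in> Nil_rad M \<or> y \<in> Nil_rad M"
proof -
  \<comment> \<open>The smaller factor is the nilpotent one, since its square lies below the
    product.\<close>
  have *: "a \<in> Nil_rad M" if "(a, b) \<in> r" "a \<otimes> b \<in> Nil_rad M" for a b
  proof -
    have "a \<in> carrier M" "b \<in> carrier M"
      using that order_carrier by auto
    then have "(a \<otimes> a, a \<otimes> b) \<in> r"
      using mult_compat[OF _ that(1), of a] by (simp add: m_comm)
    then show ?thesis
      using Nil_downward Nil_of_square that(2) \<open>a \<in> carrier M\<close> by blast
  qed
  show ?thesis
    using order_total[OF x y] *[of x y] *[of y x] xy m_comm[OF x y] by auto
qed

lemma Nil_mult_iff:
  "\<lbrakk>x \<in> carrier M; y \<in> carrier M\<rbrakk>
    \<Longrightarrow> x \<otimes> y \<in> Nil_rad M \<longleftrightarrow> x \<in> Nil_rad M \<or> y \<in> Nil_rad M"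
  using Nil_prime Nil_mult m_comm by metis

text \<open>All powers of \<open>\<one>\<close> are \<open>\<one>\<close>, so nilpotence would force
  \<open>\<one> = \<zero>\<close> and collapse the carrier.\<close>

lemma one_notin_Nil:
  assumes "carrier M \<noteq> {\<zero>}"
  shows "\<one> \<notin> Nil_rad M"
proof
  assume "\<one> \<in> Nil_rad M"
  then have "\<one> = \<zero>"
    by (simp add: Nil_rad_def)
  then have "x = \<zero>" if "x \<in> carrier M" for x
    using that l_one[of x] by simp
  then show False
    using assms by auto
qed

section \<open>The relation \<open>C_rel\<close> and its compatibility with the operations\<close>

lemma C_relI_Nil: "\<lbrakk>x \<in> Nil_rad M; y \<in> Nil_rad M\<rbrakk> \<Longrightarrow> (x, y) \<in> C_rel M"
  by (auto simp: C_rel_def Nil_carrier)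

lemma C_relI_mult:
  "\<lbrakk>x \<in> carrier M; y \<in> carrier M; s \<in> carrier M; s \<notin> Nil_rad M; s \<otimes> x = s \<otimes> y\<rbrakk>
    \<Longrightarrow> (x, y) \<in> C_rel M"
  by (auto simp: C_rel_def)

lemma C_relE:
  assumes "(x, y) \<in> C_rel M"
  obtains (Nil) "x \<in> Nil_rad M" "y \<in> Nil_rad M"
    | (mult) s where "x \<in> carrier M" "y \<in> carrier M" "s \<in> carrier M" "s \<notin> Nil_rad M"
      "s \<otimes> x = s \<otimes> y"
  using assms by (auto simp: C_rel_def)

lemma C_rel_carrier: "(x, y) \<in> C_rel M \<Longrightarrow> x \<in> carrier M \<and> y \<in> carrier M"
  by (simp add: C_rel_def)

text \<open>For a multiplier \<open>s\<close> outside the prime ideal, \<open>s \<otimes> x\<close>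
  is nilpotent exactly when \<open>x\<close> is. Hence the nilradical is a single class, that of
  zero.\<close>

lemma C_rel_Nil_iff: "(x, y) \<in> C_rel M \<Longrightarrow> x \<in> Nil_rad M \<longleftrightarrow> y \<in> Nil_rad M"
  by (erule C_relE) (use Nil_mult_iff in metis)+

lemma C_rel_zero_iff: "(x, \<zero>) \<in> C_rel M \<longleftrightarrow> x \<in> Nil_rad M"
  using C_rel_Nil_iff zero_in_Nil C_relI_Nil by blast

lemma C_rel_sym: "(x, y) \<in> C_rel M \<Longrightarrow> (y, x) \<in> C_rel M"
  by (erule C_relE) (simp_all add: C_relI_Nil, metis C_relI_mult)

lemma C_rel_trans:
  assumes "(x, y) \<in> C_rel M" "(y, z) \<in> C_rel M"
  shows "(x, z) \<in> C_rel M"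
proof (cases "y \<in> Nil_rad M")
  case True
  then show ?thesis
    using assms C_rel_Nil_iff C_relI_Nil by blast
next
  case False
  then obtain s t where st: "s \<in> carrier M" "s \<notin> Nil_rad M" "s \<otimes> x = s \<otimes> y"
      "t \<in> carrier M" "t \<notin> Nil_rad M" "t \<otimes> y = t \<otimes> z"
    using assms by (auto elim!: C_relE)
  have xyz: "x \<in> carrier M" "y \<in> carrier M" "z \<in> carrier M"
    using assms C_rel_carrier by auto
  \<comment> \<open>The product of the two multipliers works for the pair \<open>x\<close>,
    \<open>z\<close>; primality keeps it outside the nilradical.\<close>
  have "(s \<otimes> t) \<otimes> x = t \<otimes> (s \<otimes> x)"
    using st(1,4) xyz by (simp add: m_ac)
  also have "\<dots> = s \<otimes> (t \<otimes> y)"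
    using st(1,4) xyz by (simp add: st(3) m_lcomm)
  also have "\<dots> = (s \<otimes> t) \<otimes> z"
    using st(1,4) xyz by (simp add: st(6) m_assoc)
  finally show ?thesis
    using st xyz by (intro C_relI_mult[of _ _ "s \<otimes> t"]) (auto simp: Nil_mult_iff)
qed

lemma C_rel_mult:
  assumes "(x, y) \<in> C_rel M" and z: "z \<in> carrier M"
  shows "(x \<otimes> z, y \<otimes> z) \<in> C_rel M"
  using assms(1)
proof (cases rule: C_relE)
  case Nil
  then show ?thesis using z by (intro C_relI_Nil Nil_mult)
next
  case (mult s)
  then show ?thesis using z by (intro C_relI_mult[of _ _ s]) (simp_all flip: m_assoc)
qed

text \<open>A non-nilpotent \<open>z\<close> cannot lie below \<open>x\<close>, as the nilradical is
  a lower set, so \<open>z\<close> is the maximum.\<close>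

lemma add_Nil_absorb:
  assumes "x \<in> Nil_rad M" and "z \<in> carrier M" "z \<notin> Nil_rad M"
  shows "x \<oplus> z = z"
  using assms Nil_downward order_total[of x z] Nil_carrier by (auto simp: add_eq_max)

lemma C_rel_add:
  assumes "(x, y) \<in> C_rel M" and z: "z \<in> carrier M"
  shows "(x \<oplus> z, y \<oplus> z) \<in> C_rel M"
  using assms(1)
proof (cases rule: C_relE)
  case Nil
  show ?thesis
  proof (cases "z \<in> Nil_rad M")
    case True
    then show ?thesis
      using Nil by (intro C_relI_Nil) (auto simp: add_eq_max Nil_carrier)
  next
    case False
    then show ?thesis
      \<comment> \<open>Both sums equal \<open>z\<close>, which is related to itself with the
        non-nilpotent \<open>z\<close> as multiplier.\<close>
      using Nil z by (simp add: add_Nil_absorb C_relI_mult[of z z z])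
  qed
next
  case (mult s)
  then show ?thesis using z by (intro C_relI_mult[of _ _ s]) (simp_all add: r_distr)
qed

lemma homomorphic_equiv_C_rel:
  assumes "carrier M \<noteq> {\<zero>}"
  shows "homomorphic_equiv M (C_rel M)"
proof -
  have "C_rel M \<subseteq> carrier M \<times> carrier M"
    by (auto simp: C_rel_def)
  moreover have "refl_on (carrier M) (C_rel M)"
    using one_notin_Nil[OF assms] by (auto intro!: refl_onI C_relI_mult[of _ _ \<one>])
  ultimately have "equiv (carrier M) (C_rel M)"
    by (intro equivI symI transI) (auto intro: C_rel_sym C_rel_trans)
  then show ?thesis
    by (simp add: homomorphic_equiv_def C_rel_add C_rel_mult)
qed

text \<open>Cancellation in the quotient, stated on representatives: a multiplier \<open>s\<close>
  for the products becomes the multiplier \<open>s \<otimes> z\<close> for the factors,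
  non-nilpotent by primality.\<close>

lemma C_rel_cancel:
  assumes x: "x \<in> carrier M" and y: "y \<in> carrier M" and z: "z \<in> carrier M" "z \<notin> Nil_rad M"
    and xz: "(x \<otimes> z, y \<otimes> z) \<in> C_rel M"
  shows "(x, y) \<in> C_rel M"
  using xz
proof (cases rule: C_relE)
  case Nil
  then show ?thesis
    using assms by (intro C_relI_Nil) (auto simp: Nil_mult_iff)
next
  case (mult s)
  have "(s \<otimes> z) \<otimes> a = s \<otimes> (a \<otimes> z)" if "a \<in> carrier M" for a
    using that z(1) mult(3) by (simp add: m_ac)
  then show ?thesis
    using x y z mult by (intro C_relI_mult[of _ _ "s \<otimes> z"]) (simp_all add: Nil_mult_iff)
qed

text \<open>Nilpotent elements all go to zero. Otherwise the multiplier has nonzero image by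
  \<open>ker\<close>, and this image can be cancelled in \<open>N\<close>.\<close>

lemma hom_respects_C_rel:
  assumes N: "cancellative_semiring N" and h: "h \<in> semiring_hom M N"
    and ker: "{x \<in> carrier M. h x = \<zero>\<^bsub>N\<^esub>} = Nil_rad M" and xy: "(x, y) \<in> C_rel M"
  shows "h x = h y"
  using xy
proof (cases rule: C_relE)
  case Nil
  then show ?thesis by (simp flip: ker)
next
  case (mult s)
  interpret N: cancellative_semiring N by (rule N)
  have "h s \<noteq> \<zero>\<^bsub>N\<^esub>"
    using ker mult by auto
  moreover have "h x \<otimes>\<^bsub>N\<^esub> h s = h y \<otimes>\<^bsub>N\<^esub> h s"
    using mult by (simp add: m_comm flip: semiring_homD(2)[OF h])
  ultimately show ?thesis
    using mult semiring_homD(1)[OF h] N.cancel by blast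
qed

section \<open>The quotient by \<open>C_rel\<close>\<close>

context
  assumes nontrivial: "carrier M \<noteq> {\<zero>}"
begin

lemmas C_quot = commutative_semiring_axioms homomorphic_equiv_C_rel[OF nontrivial]

lemma proj_C_rel_eq_zero_iff:
  assumes "x \<in> carrier M"
  shows "Equiv_Relations.proj (C_rel M) x = \<zero>\<^bsub>quot_semiring M (C_rel M)\<^esub> \<longleftrightarrow> x \<in> Nil_rad M"
  using assms
  by (simp add: proj_eq_iff[OF C_quot] C_rel_zero_iff flip: semiring_homD(5)[OF proj_hom[OF C_quot]])

text \<open>Sums of classes are computed on representatives, so each is again one of its
  summands.\<close>

lemma ex1_bipotent_order_quot: "\<exists>!r'. bipotent_semiring (quot_semiring M (C_rel M)) r'"
proof (rule commutative_semiring.ex1_bipotent_order[OF commutative_semiring_quot[OF C_quot]])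
  fix X Y assume "X \<in> carrier (quot_semiring M (C_rel M))" "Y \<in> carrier (quot_semiring M (C_rel M))"
  then obtain x y where xy: "x \<in> carrier M" "y \<in> carrier M"
    and XY: "X = Equiv_Relations.proj (C_rel M) x" "Y = Equiv_Relations.proj (C_rel M) y"
    by (auto simp: carrier_quot_semiring[OF C_quot])
  show "X \<oplus>\<^bsub>quot_semiring M (C_rel M)\<^esub> Y \<in> {X, Y}"
    unfolding XY semiring_homD(3)[OF proj_hom[OF C_quot] xy, symmetric]
    using add_in_summands[OF xy] by auto
qed

lemma cancellative_semiring_quot: "cancellative_semiring (quot_semiring M (C_rel M))"
proof -
  interpret Q: commutative_semiring "quot_semiring M (C_rel M)"
    by (rule commutative_semiring_quot[OF C_quot])
  show ?thesis
  proof unfold_locales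
    let ?Q = "quot_semiring M (C_rel M)"
    fix X Y Z
    assume "X \<in> carrier ?Q" "Y \<in> carrier ?Q" "Z \<in> carrier ?Q"
      and Z: "Z \<noteq> \<zero>\<^bsub>?Q\<^esub>" and XZ: "X \<otimes>\<^bsub>?Q\<^esub> Z = Y \<otimes>\<^bsub>?Q\<^esub> Z"
    then obtain x y z where xyz: "x \<in> carrier M" "y \<in> carrier M" "z \<in> carrier M"
      and XYZ: "X = Equiv_Relations.proj (C_rel M) x" "Y = Equiv_Relations.proj (C_rel M) y"
        "Z = Equiv_Relations.proj (C_rel M) z"
      by (auto simp: carrier_quot_semiring[OF C_quot])
    have "z \<notin> Nil_rad M"
      using Z xyz by (simp add: XYZ proj_C_rel_eq_zero_iff)
    moreover have "(x \<otimes> z, y \<otimes> z) \<in> C_rel M"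
      using XZ xyz
      by (simp add: XYZ proj_eq_iff[OF C_quot] flip: semiring_homD(2)[OF proj_hom[OF C_quot]])
    ultimately show "X = Y"
      using xyz C_rel_cancel by (simp add: XYZ proj_eq_iff[OF C_quot])
  qed
qed

end

end

theorem theorem2p2:
  fixes M :: "('a, 'm) ring_scheme" and r :: "('a \<times> 'a) set"
    and N :: "('b, 'n) ring_scheme"
  assumes "bipotent_semiring M r" and "carrier M \<noteq> {\<zero>\<^bsub>M\<^esub>}"
  shows
    "(let C = C_rel M; Q = quot_semiring M C; \<pi> = Equiv_Relations.proj C in
      \<comment> \<open>a)\<close>
      (homomorphic_equiv M C \<and>
       (\<exists>!r'. bipotent_semiring Q r') \<and>
       \<pi> \<in> semiring_hom M Q \<and>
       (\<forall>Q' :: 'a set ring. commutative_semiring Q' \<and> carrier Q' = carrier M // C \<and> \<pi> \<in> semiring_hom M Q'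
          \<longrightarrow> same_structure Q' Q)) \<and>
      \<comment> \<open>b)\<close>
      (cancellative_semiring Q \<and> {x \<in> carrier M. \<pi> x = \<zero>\<^bsub>Q\<^esub>} = Nil_rad M) \<and>
      \<comment> \<open>c)\<close>
      (\<forall>\<gamma>. cancellative_semiring N \<and> \<gamma> \<in> semiring_hom M N \<and>
            {x \<in> carrier M. \<gamma> x = \<zero>\<^bsub>N\<^esub>} = Nil_rad M
         \<longrightarrow> (\<exists>!g. g \<in> semiring_hom Q N \<and> g \<in> extensional (carrier Q) \<and>
                   (\<forall>x \<in> carrier M. g (\<pi> x) = \<gamma> x))))"
proof -
  interpret bipotent_semiring M r by (rule assms(1))
  note C_quot = C_quot[OF assms(2)]
  have "same_structure Q' (quot_semiring M (C_rel M))"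
    if "carrier Q' = carrier M // C_rel M" "Equiv_Relations.proj (C_rel M) \<in> semiring_hom M Q'"
    for Q' :: "'a set ring"
    using that same_structure_of_surj_hom[OF proj_hom[OF C_quot] _ carrier_quot_semiring[OF C_quot]]
    by (simp add: carrier_quot_semiring[OF C_quot] proj_image)
  moreover have "{x \<in> carrier M. Equiv_Relations.proj (C_rel M) x = \<zero>\<^bsub>quot_semiring M (C_rel M)\<^esub>}
      = Nil_rad M"
    using proj_C_rel_eq_zero_iff[OF assms(2)] Nil_carrier by auto
  moreover have "\<exists>!g. g \<in> semiring_hom (quot_semiring M (C_rel M)) N \<and>
      g \<in> extensional (carrier (quot_semiring M (C_rel M))) \<and>
      (\<forall>x \<in> carrier M. g (Equiv_Relations.proj (C_rel M) x) = \<gamma> x)"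
    if "cancellative_semiring N" "\<gamma> \<in> semiring_hom M N"
      "{x \<in> carrier M. \<gamma> x = \<zero>\<^bsub>N\<^esub>} = Nil_rad M" for \<gamma>
    \<comment> \<open>Cancellativity of \<open>N\<close> and the kernel condition enter only through
      constancy of \<open>\<gamma>\<close> on classes.\<close>
    by (rule hom_factors_uniquely[OF C_quot that(2) hom_respects_C_rel[OF that]])
  ultimately show ?thesis
    using C_quot(2) ex1_bipotent_order_quot[OF assms(2)] proj_hom[OF C_quot]
      cancellative_semiring_quot[OF assms(2)]
    unfolding Let_def by (intro conjI allI impI; (elim conjE)?) (assumption | blast)+
qed

end
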